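(* Let $n\ge 1$ be an integer, let $\kappa_1,\kappa_2\ge 0$ be integers, and set $N=n+\kappa_1+\kappa_2$, $\beta_{\boldsymbol\kappa}=\frac{2\kappa_1}{N}$, $\gamma_{\boldsymbol\kappa}=\frac{2\kappa_2}{N}$. Write the Chebyshev points as $\mathcal{T}_N=\{t_j\}_{j=1,\dots,N}$ and the Chebyshev-Lobatto points as $\mathcal{U}_{N+1}=\{u_j\}_{j=0,\dots,N}$. Then $$\mathcal{T}^{\beta_{\boldsymbol\kappa},\gamma_{\boldsymbol\kappa}}_{n}=\mathcal{T}_{N}\setminus\{t_1,\dots,t_{\kappa_2},\,t_{n+\kappa_2+1},\dots,t_{N}\},$$ $$\mathcal{U}^{\beta_{\boldsymbol\kappa},\gamma_{\boldsymbol\kappa}}_{n+1}=\mathcal{U}_{N+1}\setminus\{u_0,\dots,u_{\kappa_2-1},\,u_{n+\kappa_2+1},\dots,u_{N}\}.$$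
   Context: For an integer $N\ge1$, the Chebyshev points are $t_j=\cos\big(\frac{(2j-1)\pi}{2N}\big)$, $j=1,\dots,N$, and $\mathcal{T}_N=\{t_1,\dots,t_N\}$; the Chebyshev-Lobatto points are $u_j=\cos\big(\frac{j\pi}{N}\big)$, $j=0,\dots,N$, and $\mathcal{U}_{N+1}=\{u_0,\dots,u_N\}$. For $\beta,\gamma\in[0,2)$ with $\beta+\gamma<2$ and an integer $n\ge1$, the $(\beta,\gamma)$-Chebyshev points and the $(\beta,\gamma)$-Chebyshev-Lobatto points are $$\mathcal{T}^{\beta,\gamma}_n=\Big\{\cos\Big(\frac{(2-\beta-\gamma)(2j-1)\pi}{4n}+\frac{\gamma\pi}{2}\Big)\Big\}_{j=1,\dots,n},\qquad \mathcal{U}^{\beta,\gamma}_{n+1}=\Big\{\cos\Big(\frac{(2-\beta-\gamma)j\pi}{2n}+\frac{\gamma\pi}{2}\Big)\Big\}_{j=0,\dots,n}.$$ Index ranges whose lower bound exceeds the upper bound are empty (e.g. $t_1,\dots,t_{\kappa_2}$ when $\kappa_2=0$). *)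

theory Defs
  imports Complex_Main
begin

definition cheb_point :: "nat \<Rightarrow> nat \<Rightarrow> real" where
  "cheb_point N j = cos ((2 * real j - 1) * pi / (2 * real N))"

definition cheb_points :: "nat \<Rightarrow> real set" where
  "cheb_points N = cheb_point N ` {1..N}"

definition lobatto_point :: "nat \<Rightarrow> nat \<Rightarrow> real" where
  "lobatto_point N j = cos (real j * pi / real N)"

text \<open>The argument is the largest index \<open>N\<close>, so this is the set written \<open>U\<close> with subscript
  \<open>N + 1\<close> in the literature. The same shift applies to \<open>bg_lobatto_points\<close>.\<close>

definition lobatto_points :: "nat \<Rightarrow> real set" where
  "lobatto_points N = lobatto_point N ` {0..N}"

text \<open>The two-parameter families are meant for \<open>n \<ge> 1\<close> and \<open>\<beta>, \<gamma> \<in> [0, 2)\<close> with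
  \<open>\<beta> + \<gamma> < 2\<close>.\<close>

definition bg_cheb_points :: "real \<Rightarrow> real \<Rightarrow> nat \<Rightarrow> real set" where
  "bg_cheb_points \<beta> \<gamma> n =
    (\<lambda>j. cos ((2 - \<beta> - \<gamma>) * (2 * real j - 1) * pi / (4 * real n) + \<gamma> * pi / 2)) ` {1..n}"

definition bg_lobatto_points :: "real \<Rightarrow> real \<Rightarrow> nat \<Rightarrow> real set" where
  "bg_lobatto_points \<beta> \<gamma> n =
    (\<lambda>j. cos ((2 - \<beta> - \<gamma>) * real j * pi / (2 * real n) + \<gamma> * pi / 2)) ` {0..n}"

lemma bg_parameters_admissible:
  fixes n k1 k2 N :: nat
  assumes "n \<ge> 1" and "N = n + k1 + k2"
  shows "2 * real k1 / real N \<in> {0..<2}" and "2 * real k2 / real N \<in> {0..<2}"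
    and "2 * real k1 / real N + 2 * real k2 / real N < 2"
  using assms by (auto simp: divide_simps simp flip: add_divide_distrib)

end

theory Submission
  imports Defs
begin

text \<open>Since \<open>2 - \<beta> - \<gamma> = 2n / N\<close>, the angle of the \<open>j\<close>-th point of either two-parameter family is
  the angle of the \<open>(j + \<kappa>\<^sub>2)\<close>-th classical point. Cosine is injective on \<open>[0, \<pi>]\<close>, so removing
  points from the classical families amounts to removing their indices.\<close>

text \<open>For indices from 1 to \<open>N\<close> the odd factor \<open>2 * real k - 1\<close> lies
  between 1 and \<open>2 * real N - 1\<close>, which places every angle in the interval where
  \<open>cos_inj_pi\<close> applies.\<close>

lemma inj_on_cheb_point: "inj_on (cheb_point N) {1..N}"
proof (rule inj_onI)
  fix i j assume ij: "i \<in> {1..N}" "j \<in> {1..N}" and eq: "cheb_point N i = cheb_point N j"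
  have range: "0 \<le> (2 * real k - 1) * pi / (2 * real N) \<and> (2 * real k - 1) * pi / (2 * real N) \<le> pi"
    if "k \<in> {1..N}" for k
  proof -
    have "(2 * real k - 1) * pi \<le> (2 * real N) * pi"
      using that by (intro mult_right_mono) auto
    with that show ?thesis by (simp add: pos_divide_le_eq mult.commute)
  qed
  have "(2 * real i - 1) * pi / (2 * real N) = (2 * real j - 1) * pi / (2 * real N)"
    using range[OF ij(1)] range[OF ij(2)] eq unfolding cheb_point_def by (blast intro: cos_inj_pi)
  \<comment> \<open>Membership of \<open>i\<close> in \<open>{1..N}\<close> forces \<open>N\<close>
    to be positive, so the common denominator cancels.\<close>
  with ij show "i = j" by simp
qed

lemma inj_on_lobatto_point:
  assumes "N \<ge> 1"
  shows "inj_on (lobatto_point N) {0..N}"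
proof (rule inj_onI)
  fix i j assume ij: "i \<in> {0..N}" "j \<in> {0..N}" and eq: "lobatto_point N i = lobatto_point N j"
  have range: "0 \<le> real k * pi / real N \<and> real k * pi / real N \<le> pi" if "k \<in> {0..N}" for k
    using that assms by (simp add: pos_divide_le_eq mult.commute)
  have "real i * pi / real N = real j * pi / real N"
    using range[OF ij(1)] range[OF ij(2)] eq unfolding lobatto_point_def by (blast intro: cos_inj_pi)
  with assms show "i = j" by simp
qed

context
  fixes n \<kappa>\<^sub>1 \<kappa>\<^sub>2 N :: nat and \<beta> \<gamma> :: real
  assumes n: "n \<ge> 1"
    and N: "N = n + \<kappa>\<^sub>1 + \<kappa>\<^sub>2"
    and \<beta>: "\<beta> = 2 * real \<kappa>\<^sub>1 / real N"
    and \<gamma>: "\<gamma> = 2 * real \<kappa>\<^sub>2 / real N"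
begin

text \<open>The factor \<open>real n\<close> cancels the one in the denominators of the
  two-parameter angles, leaving the classical grid spacing \<open>pi / real N\<close>.\<close>

lemma two_minus_parameters: "2 - \<beta> - \<gamma> = 2 * real n / real N"
proof -
  have "real N > 0" using n N by simp
  then have "2 - \<beta> - \<gamma> = (2 * real N - 2 * real \<kappa>\<^sub>1 - 2 * real \<kappa>\<^sub>2) / real N"
    unfolding \<beta> \<gamma> by (simp add: diff_divide_distrib)
  also have "2 * real N - 2 * real \<kappa>\<^sub>1 - 2 * real \<kappa>\<^sub>2 = 2 * real n" using N by simp
  finally show ?thesis .
qed

text \<open>The offset \<open>\<gamma> * pi / 2\<close> equals \<open>\<kappa>\<^sub>2\<close> grid
  steps of length \<open>pi / real N\<close>, hence the index shift.\<close>

lemma bg_cheb_points_eq_image: "bg_cheb_points \<beta> \<gamma> n = cheb_point N ` {\<kappa>\<^sub>2 + 1..n + \<kappa>\<^sub>2}"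
proof -
  have "real n > 0" "real N > 0" using n N by simp_all
  then have "(2 - \<beta> - \<gamma>) * (2 * real j - 1) * pi / (4 * real n) + \<gamma> * pi / 2
      = (2 * real (j + \<kappa>\<^sub>2) - 1) * pi / (2 * real N)" for j
    \<comment> \<open>The order matters: expanding \<open>\<gamma>\<close> first would destroy the
      pattern \<open>2 - \<beta> - \<gamma>\<close>.\<close>
    unfolding two_minus_parameters unfolding \<gamma> by (simp add: field_simps)
  then have "bg_cheb_points \<beta> \<gamma> n = cheb_point N ` (\<lambda>j. j + \<kappa>\<^sub>2) ` {1..n}"
    unfolding bg_cheb_points_def cheb_point_def image_image by simp
  then show ?thesis by (simp only: image_add_atLeastAtMost' add.commute)
qed

lemma bg_lobatto_points_eq_image: "bg_lobatto_points \<beta> \<gamma> n = lobatto_point N ` {\<kappa>\<^sub>2..n + \<kappa>\<^sub>2}"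
proof -
  have "real n > 0" "real N > 0" using n N by simp_all
  then have "(2 - \<beta> - \<gamma>) * real j * pi / (2 * real n) + \<gamma> * pi / 2 = real (j + \<kappa>\<^sub>2) * pi / real N" for j
    unfolding two_minus_parameters unfolding \<gamma> by (simp add: field_simps)
  then have "bg_lobatto_points \<beta> \<gamma> n = lobatto_point N ` (\<lambda>j. j + \<kappa>\<^sub>2) ` {0..n}"
    unfolding bg_lobatto_points_def lobatto_point_def image_image by simp
  then show ?thesis by (simp only: image_add_atLeastAtMost' add_0)
qed

end

text \<open>The half-open \<open>{0..<\<kappa>\<^sub>2}\<close> is empty for
  \<open>\<kappa>\<^sub>2 = 0\<close>, whereas truncated subtraction would leave the index 0 in
  \<open>{0..\<kappa>\<^sub>2 - 1}\<close>.\<close>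

theorem theorem2:
  fixes n \<kappa>\<^sub>1 \<kappa>\<^sub>2 N :: nat and \<beta> \<gamma> :: real
  assumes "n \<ge> 1"
    and "N = n + \<kappa>\<^sub>1 + \<kappa>\<^sub>2"
    and "\<beta> = 2 * real \<kappa>\<^sub>1 / real N"
    and "\<gamma> = 2 * real \<kappa>\<^sub>2 / real N"
  shows "bg_cheb_points \<beta> \<gamma> n =
      cheb_points N - cheb_point N ` ({1..\<kappa>\<^sub>2} \<union> {n + \<kappa>\<^sub>2 + 1..N})
    \<and> bg_lobatto_points \<beta> \<gamma> n =
      lobatto_points N - lobatto_point N ` ({0..<\<kappa>\<^sub>2} \<union> {n + \<kappa>\<^sub>2 + 1..N})"
proof
  \<comment> \<open>Injectivity turns a difference of images into the image of a difference; the
    formula for \<open>N\<close> keeps the removed indices inside \<open>{1..N}\<close>.\<close>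
  have "cheb_points N - cheb_point N ` ({1..\<kappa>\<^sub>2} \<union> {n + \<kappa>\<^sub>2 + 1..N})
      = cheb_point N ` ({1..N} - ({1..\<kappa>\<^sub>2} \<union> {n + \<kappa>\<^sub>2 + 1..N}))"
    unfolding cheb_points_def using assms(2)
    by (intro inj_on_image_set_diff[OF inj_on_cheb_point, symmetric]) auto
  also have "{1..N} - ({1..\<kappa>\<^sub>2} \<union> {n + \<kappa>\<^sub>2 + 1..N}) = {\<kappa>\<^sub>2 + 1..n + \<kappa>\<^sub>2}"
    using assms(2) by auto
  finally show "bg_cheb_points \<beta> \<gamma> n =
      cheb_points N - cheb_point N ` ({1..\<kappa>\<^sub>2} \<union> {n + \<kappa>\<^sub>2 + 1..N})"
    using bg_cheb_points_eq_image[OF assms] by simp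
next
  have "N \<ge> 1" using assms(1,2) by simp
  then have "lobatto_points N - lobatto_point N ` ({0..<\<kappa>\<^sub>2} \<union> {n + \<kappa>\<^sub>2 + 1..N})
      = lobatto_point N ` ({0..N} - ({0..<\<kappa>\<^sub>2} \<union> {n + \<kappa>\<^sub>2 + 1..N}))"
    unfolding lobatto_points_def using assms(2)
    by (intro inj_on_image_set_diff[OF inj_on_lobatto_point, symmetric]) auto
  \<comment> \<open>Index \<open>\<kappa>\<^sub>2\<close> itself survives here, unlike in the
    Chebyshev case, so \<open>n + 1\<close> indices remain.\<close>
  also have "{0..N} - ({0..<\<kappa>\<^sub>2} \<union> {n + \<kappa>\<^sub>2 + 1..N}) = {\<kappa>\<^sub>2..n + \<kappa>\<^sub>2}"
    using assms(2) by auto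
  finally show "bg_lobatto_points \<beta> \<gamma> n =
      lobatto_points N - lobatto_point N ` ({0..<\<kappa>\<^sub>2} \<union> {n + \<kappa>\<^sub>2 + 1..N})"
    using bg_lobatto_points_eq_image[OF assms] by simp
qed

end
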